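(* Let $m$ be a positive integer, let $r,t$ be integers with $0\leq r\leq t\leq m$, and let $s_1,\dots,s_t$ be positive integers such that $s_1,\dots,s_r$ are even, $s_{r+1},\dots,s_t$ are odd, and $s_t\mid\cdots\mid s_1$. Let $D_m(\bm{s})$ be the $m\times(m^2-m+t)$ integer matrix whose columns are $s_1\bm{e}_1,\dots,s_t\bm{e}_t$ together with $\bm{e}_i-\bm{e}_j$ and $\bm{e}_i+\bm{e}_j$ for $1\leq i<j\leq m$, where $\bm{e}_i\in\mathbb{Z}^m$ is the $i$th standard unit column vector. Let $\rho:=\operatorname{lcm}(s_1,2)$ if $t\geq 1$ and $\rho:=2$ if $t=0$. Let $k$ be a positive integer with $k\mid\rho$ and put $d_i:=\gcd(k,s_i)$ for $1\leq i\leq t$. For $q\in k+\rho\mathbb{Z}_{\geq 0}$ let $\chi^k_{D_m(\bm{s})}(q)$ denote the number of $\bm{x}=(x_1,\dots,x_m)\in\mathbb{Z}_q^m$ such that every entry of $\bm{x}[D_m(\bm{s})]_q$ is nonzero, i.e. $s_ix_i\neq0$ for $1\leq i\leq t$ and $x_i-x_j\neq 0$, $x_i+x_j\neq 0$ for $1\leq i<j\leq m$. Then: If $k$ is odd, for all $q\in k+\rho\mathbb{Z}_{\geq 0}$, $$\chi^k_{D_m(\bm{s})}(q)=\prod_{i=1}^{t}(q-d_i-2i+2)\left(\prod_{i=t+1}^{m}(q-2i+1)+(m-t)\prod_{i=t+1}^{m-1}(q-2i+1)\right).$$ If $k$ is even, for all $q\in k+\rho\mathbb{Z}_{\geq 0}$,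 $$\chi^k_{D_m(\bm{s})}(q)=\prod_{i=1}^{r}(q-d_i-2i+2)\,(P_1+P_2),$$ where $$P_1:=\prod_{i=r+1}^{t}(q-d_i-2i+1)\left(\prod_{i=t+1}^{m}(q-2i)+2(m-t)\prod_{i=t+1}^{m-1}(q-2i)+(m-t)(m-t-1)\prod_{i=t+1}^{m-2}(q-2i)\right),$$ $$P_2:=\left(\sum_{i=r+1}^{t}\prod_{j=r+1}^{i-1}(q-d_j-2j+1)\prod_{j=i+1}^{t}(q-d_j-2j+3)\right)\left(\prod_{i=t+1}^{m}(q-2i+2)+(m-t)\prod_{i=t+1}^{m-1}(q-2i+2)\right).$$ In particular, if $t=m$: for $k$ odd, $\chi^k_{D_m(\bm{s})}(q)=\prod_{i=1}^{m}(q-d_i-2i+2)$; for $k$ even, $$\chi^k_{D_m(\bm{s})}(q)=\prod_{i=1}^{r}(q-d_i-2i+2)\left(\prod_{i=r+1}^{m}(q-d_i-2i+1)+\sum_{i=r+1}^{m}\prod_{j=r+1}^{i-1}(q-d_j-2j+1)\prod_{j=i+1}^{m}(q-d_j-2j+3)\right).$$ Equivalently, these polynomials are the $k$-constituents of the characteristic quasi-polynomial of $D_m(\bm{s})$ with respect to the period $\rho$.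
   Context: $\mathbb{Z}_q=\mathbb{Z}/q\mathbb{Z}$ and $[S]_q$ denotes entrywise reduction mod $q$. For an integer matrix $S$ with $m$ rows and $n$ columns, the characteristic quasi-polynomial is $q\mapsto\#\{\bm{x}\in\mathbb{Z}_q^m\mid\bm{x}[S]_q\in(\mathbb{Z}_q\setminus\{0\})^n\}$, a quasi-polynomial with period $\rho$; its $k$-constituent is the polynomial agreeing with it for $q\equiv k\pmod\rho$. Empty sums equal $0$ and empty products equal $1$. *)

theory Defs
  imports
    "HOL-Number_Theory.Cong"
    "HOL-Computational_Algebra.Polynomial"
    "Jordan_Normal_Form.Matrix"
begin

definition mat_mod :: "nat \<Rightarrow> int mat \<Rightarrow> int mat" where
  "mat_mod q S = map_mat (\<lambda>a. a mod int q) S"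

(* The ring of integers modulo q is represented by the residues 0, ..., q - 1.  A vector x is a
   row vector, so the j-th entry of its product with the reduced matrix is the scalar product
   of x with the j-th column; it is zero in the ring iff it is 0 modulo q. *)
definition char_quasi_poly :: "int mat \<Rightarrow> nat \<Rightarrow> nat" where
  "char_quasi_poly S q =
     card {x \<in> carrier_vec (dim_row S).
             (\<forall>i < dim_row S. x $ i \<in> {0..<int q}) \<and>
             (\<forall>j < dim_col S. (x \<bullet> col (mat_mod q S) j) mod int q \<noteq> 0)}"

(* Functions on the positive integers; the value at 0 is irrelevant. *)
definition is_quasi_polynomial :: "(nat \<Rightarrow> nat) \<Rightarrow> nat \<Rightarrow> bool" where
  "is_quasi_polynomial f \<rho> \<longleftrightarrow>
     0 < \<rho> \<and>
     (\<forall>k. \<exists>p :: int poly. \<forall>q > 0. [q = k] (mod \<rho>) \<longrightarrow> int (f q) = poly p (int q))"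

definition constituent :: "(nat \<Rightarrow> nat) \<Rightarrow> nat \<Rightarrow> nat \<Rightarrow> int poly" where
  "constituent f \<rho> k =
     (THE p. \<forall>q > 0. [q = k] (mod \<rho>) \<longrightarrow> int (f q) = poly p (int q))"

(* Standard unit vectors numbered from 1, whereas vector entries are numbered from 0. *)
definition e_vec :: "nat \<Rightarrow> nat \<Rightarrow> int vec" where
  "e_vec m i = unit_vec m (i - 1)"

definition D_cols :: "nat \<Rightarrow> nat \<Rightarrow> (nat \<Rightarrow> nat) \<Rightarrow> int vec list" where
  "D_cols m t s =
     [int (s i) \<cdot>\<^sub>v e_vec m i. i \<leftarrow> [1..<Suc t]] @
     [e_vec m i - e_vec m j. i \<leftarrow> [1..<Suc m], j \<leftarrow> [Suc i..<Suc m]] @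
     [e_vec m i + e_vec m j. i \<leftarrow> [1..<Suc m], j \<leftarrow> [Suc i..<Suc m]]"

definition D_mat :: "nat \<Rightarrow> nat \<Rightarrow> (nat \<Rightarrow> nat) \<Rightarrow> int mat" where
  "D_mat m t s = mat_of_cols m (D_cols m t s)"

definition D_period :: "nat \<Rightarrow> (nat \<Rightarrow> nat) \<Rightarrow> nat" where
  "D_period t s = (if 1 \<le> t then lcm (s 1) 2 else 2)"

(* The formulas below are stated over an arbitrary commutative ring so that x can be either an
   integer q or the polynomial variable.  An upper bound such as m - 2 is truncated at 0, which
   does not matter since the interval is then empty anyway. *)

definition chi_odd ::
  "nat \<Rightarrow> nat \<Rightarrow> (nat \<Rightarrow> nat) \<Rightarrow> 'a::comm_ring_1 \<Rightarrow> 'a" where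
  "chi_odd m t d x =
     (\<Prod>i = 1..t. x - of_nat (d i) - 2 * of_nat i + 2) *
     ((\<Prod>i = t+1..m. x - 2 * of_nat i + 1) +
      of_nat (m - t) * (\<Prod>i = t+1..m-1. x - 2 * of_nat i + 1))"

definition chi_even_P1 ::
  "nat \<Rightarrow> nat \<Rightarrow> nat \<Rightarrow> (nat \<Rightarrow> nat) \<Rightarrow> 'a::comm_ring_1 \<Rightarrow> 'a" where
  "chi_even_P1 m r t d x =
     (\<Prod>i = r+1..t. x - of_nat (d i) - 2 * of_nat i + 1) *
     ((\<Prod>i = t+1..m. x - 2 * of_nat i) +
      2 * of_nat (m - t) * (\<Prod>i = t+1..m-1. x - 2 * of_nat i) +
      of_nat (m - t) * (of_nat (m - t) - 1) * (\<Prod>i = t+1..m-2. x - 2 * of_nat i))"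

definition chi_even_P2 ::
  "nat \<Rightarrow> nat \<Rightarrow> nat \<Rightarrow> (nat \<Rightarrow> nat) \<Rightarrow> 'a::comm_ring_1 \<Rightarrow> 'a" where
  "chi_even_P2 m r t d x =
     (\<Sum>i = r+1..t.
        (\<Prod>j = r+1..i-1. x - of_nat (d j) - 2 * of_nat j + 1) *
        (\<Prod>j = i+1..t. x - of_nat (d j) - 2 * of_nat j + 3)) *
     ((\<Prod>i = t+1..m. x - 2 * of_nat i + 2) +
      of_nat (m - t) * (\<Prod>i = t+1..m-1. x - 2 * of_nat i + 2))"

definition chi_even ::
  "nat \<Rightarrow> nat \<Rightarrow> nat \<Rightarrow> (nat \<Rightarrow> nat) \<Rightarrow> 'a::comm_ring_1 \<Rightarrow> 'a" where
  "chi_even m r t d x =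
     (\<Prod>i = 1..r. x - of_nat (d i) - 2 * of_nat i + 2) * (chi_even_P1 m r t d x + chi_even_P2 m r t d x)"

definition chi_odd_full ::
  "nat \<Rightarrow> (nat \<Rightarrow> nat) \<Rightarrow> 'a::comm_ring_1 \<Rightarrow> 'a" where
  "chi_odd_full m d x = (\<Prod>i = 1..m. x - of_nat (d i) - 2 * of_nat i + 2)"

definition chi_even_full ::
  "nat \<Rightarrow> nat \<Rightarrow> (nat \<Rightarrow> nat) \<Rightarrow> 'a::comm_ring_1 \<Rightarrow> 'a" where
  "chi_even_full m r d x =
     (\<Prod>i = 1..r. x - of_nat (d i) - 2 * of_nat i + 2) *
     ((\<Prod>i = r+1..m. x - of_nat (d i) - 2 * of_nat i + 1) +
      (\<Sum>i = r+1..m.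
         (\<Prod>j = r+1..i-1. x - of_nat (d j) - 2 * of_nat j + 1) *
         (\<Prod>j = i+1..m. x - of_nat (d j) - 2 * of_nat j + 3)))"

lemma length_pairs:
  "2 * (\<Sum>i\<leftarrow>[1..<Suc m]. m - i) = m\<^sup>2 - m"
proof -
  have "(\<Sum>i\<leftarrow>[1..<Suc m]. m - i) = (\<Sum>i = 1..<Suc m. m - i)"
    by (simp only: interv_sum_list_conv_sum_set_nat set_upt)
  also have "\<dots> = (\<Sum>i = 0..<m. i)"
    by (rule sum.reindex_bij_witness[where i = "\<lambda>i. m - i" and j = "\<lambda>i. m - i"]) auto
  also have "2 * \<dots> = m\<^sup>2 - m"
  proof (induction m)
    case (Suc m)
    have "m \<le> m * m"
      by (rule le_square)
    then show ?case
      using Suc by (simp add: power2_eq_square)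
  qed simp
  finally show ?thesis .
qed

lemma D_mat_carrier: "D_mat m t s \<in> carrier_mat m (m\<^sup>2 - m + t)"
  unfolding D_mat_def D_cols_def carrier_mat_def
  using length_pairs[of m] by (simp add: length_concat o_def del: upt_Suc)

lemma mod_col_mat_mod:
  assumes "x \<in> carrier_vec (dim_row S)" and "j < dim_col S"
  shows "(x \<bullet> col (mat_mod q S) j) mod int q = (x \<bullet> col S j) mod int q"
proof -
  have "(\<Sum>i = 0..<dim_row S. x $ i * (S $$ (i, j) mod int q)) mod int q =
        (\<Sum>i = 0..<dim_row S. x $ i * (S $$ (i, j) mod int q) mod int q) mod int q"
    by (rule mod_sum_eq[symmetric])
  also have "\<dots> = (\<Sum>i = 0..<dim_row S. x $ i * S $$ (i, j) mod int q) mod int q"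
    by (simp only: mod_mult_right_eq)
  also have "\<dots> = (\<Sum>i = 0..<dim_row S. x $ i * S $$ (i, j)) mod int q"
    by (rule mod_sum_eq)
  finally have "(\<Sum>i = 0..<dim_row S. x $ i * (S $$ (i, j) mod int q)) mod int q =
      (\<Sum>i = 0..<dim_row S. x $ i * S $$ (i, j)) mod int q" .
  then show ?thesis
    using assms by (simp add: scalar_prod_def mat_mod_def)
qed

lemma set_D_cols:
  "set (D_cols m t s) =
     {int (s i) \<cdot>\<^sub>v e_vec m i | i. 1 \<le> i \<and> i \<le> t} \<union>
     {e_vec m i - e_vec m j | i j. 1 \<le> i \<and> i < j \<and> j \<le> m} \<union>
     {e_vec m i + e_vec m j | i j. 1 \<le> i \<and> i < j \<and> j \<le> m}"
proof -
  have pairs: "set [f i j. i \<leftarrow> [1..<Suc m], j \<leftarrow> [Suc i..<Suc m]] =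
      {f i j | i j. 1 \<le> i \<and> i < j \<and> j \<le> m}" for f :: "nat \<Rightarrow> nat \<Rightarrow> int vec"
  proof (rule Set.set_eqI)
    fix c
    have "c \<in> set [f i j. i \<leftarrow> [1..<Suc m], j \<leftarrow> [Suc i..<Suc m]] \<longleftrightarrow>
          (\<exists>i\<in>{1..<Suc m}. \<exists>j\<in>{Suc i..<Suc m}. c = f i j)"
      by (simp add: image_iff del: upt_Suc)
    also have "\<dots> \<longleftrightarrow> (\<exists>i j. c = f i j \<and> 1 \<le> i \<and> i < j \<and> j \<le> m)"
    proof -
      have "i \<in> {1..<Suc m} \<and> j \<in> {Suc i..<Suc m} \<longleftrightarrow> 1 \<le> i \<and> i < j \<and> j \<le> m" for i j
        by auto
      then show ?thesis
        by blast
    qed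
    finally show "c \<in> set [f i j. i \<leftarrow> [1..<Suc m], j \<leftarrow> [Suc i..<Suc m]] \<longleftrightarrow>
        c \<in> {f i j | i j. 1 \<le> i \<and> i < j \<and> j \<le> m}"
      by simp
  qed
  have "set [int (s i) \<cdot>\<^sub>v e_vec m i. i \<leftarrow> [1..<Suc t]] =
      {int (s i) \<cdot>\<^sub>v e_vec m i | i. 1 \<le> i \<and> i \<le> t}"
    by (auto simp: less_Suc_eq_le simp del: upt_Suc)
  then show ?thesis
    unfolding D_cols_def set_append pairs by blast
qed

(* The entrywise description of the counted vectors. *)
lemma char_quasi_poly_D_mat:
  assumes "t \<le> m"
  shows "char_quasi_poly (D_mat m t s) q =
    card {x \<in> carrier_vec m.
            (\<forall>i < m. x $ i \<in> {0..<int q}) \<and>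
            (\<forall>i\<in>{1..t}. int (s i) * x $ (i - 1) mod int q \<noteq> 0) \<and>
            (\<forall>j\<in>{1..m}. \<forall>i\<in>{1..<j}.
               (x $ (i - 1) - x $ (j - 1)) mod int q \<noteq> 0 \<and>
               (x $ (i - 1) + x $ (j - 1)) mod int q \<noteq> 0)}"
proof -
  have "(\<forall>l < dim_col (D_mat m t s). (x \<bullet> col (mat_mod q (D_mat m t s)) l) mod int q \<noteq> 0) \<longleftrightarrow>
        (\<forall>i\<in>{1..t}. int (s i) * x $ (i - 1) mod int q \<noteq> 0) \<and>
        (\<forall>j\<in>{1..m}. \<forall>i\<in>{1..<j}.
           (x $ (i - 1) - x $ (j - 1)) mod int q \<noteq> 0 \<and>
           (x $ (i - 1) + x $ (j - 1)) mod int q \<noteq> 0)" (is "?L \<longleftrightarrow> ?R")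
    if x: "x \<in> carrier_vec m" for x
  proof -
    have carrier: "c \<in> carrier_vec m" if "c \<in> set (D_cols m t s)" for c
      using that by (auto simp: set_D_cols e_vec_def)
    have "?L \<longleftrightarrow> (\<forall>l < length (D_cols m t s). (x \<bullet> (D_cols m t s ! l)) mod int q \<noteq> 0)"
    proof -
      have "x \<in> carrier_vec (dim_row (D_mat m t s))"
        using x by (simp add: D_mat_def)
      moreover have "dim_col (D_mat m t s) = length (D_cols m t s)"
        by (simp add: D_mat_def)
      moreover have "col (D_mat m t s) l = D_cols m t s ! l" if "l < length (D_cols m t s)" for l
        using that carrier by (simp add: D_mat_def)
      ultimately show ?thesis
        by (simp add: mod_col_mat_mod)
    qed
    also have "\<dots> \<longleftrightarrow> (\<forall>c \<in> set (D_cols m t s). (x \<bullet> c) mod int q \<noteq> 0)"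
      by (metis in_set_conv_nth)
    also have "\<dots> \<longleftrightarrow>
        (\<forall>i. 1 \<le> i \<and> i \<le> t \<longrightarrow> (x \<bullet> (int (s i) \<cdot>\<^sub>v e_vec m i)) mod int q \<noteq> 0) \<and>
        (\<forall>i j. 1 \<le> i \<and> i < j \<and> j \<le> m \<longrightarrow> (x \<bullet> (e_vec m i - e_vec m j)) mod int q \<noteq> 0) \<and>
        (\<forall>i j. 1 \<le> i \<and> i < j \<and> j \<le> m \<longrightarrow> (x \<bullet> (e_vec m i + e_vec m j)) mod int q \<noteq> 0)"
    proof -
      have "(\<forall>c \<in> {f i | i. P i}. Q c) \<longleftrightarrow> (\<forall>i. P i \<longrightarrow> Q (f i))"
        for f :: "nat \<Rightarrow> int vec" and P Q
        by blast
      moreover have "(\<forall>c \<in> {f i j | i j. P i j}. Q c) \<longleftrightarrow> (\<forall>i j. P i j \<longrightarrow> Q (f i j))"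
        for f :: "nat \<Rightarrow> nat \<Rightarrow> int vec" and P Q
        by blast
      ultimately show ?thesis
        unfolding set_D_cols ball_Un by (simp only: conj_assoc)
    qed
    also have "\<dots> \<longleftrightarrow> ?R"
    proof -
      have e: "e_vec m i \<in> carrier_vec m" for i
        by (simp add: e_vec_def)
      have xe: "x \<bullet> e_vec m i = x $ (i - 1)" if "1 \<le> i" "i \<le> m" for i
        using x that by (simp add: e_vec_def)
      have 1: "x \<bullet> (int (s i) \<cdot>\<^sub>v e_vec m i) = int (s i) * x $ (i - 1)"
        if "1 \<le> i \<and> i \<le> t" for i
        using x e xe that assms by simp
      have 2: "x \<bullet> (e_vec m i - e_vec m j) = x $ (i - 1) - x $ (j - 1)"
        and 3: "x \<bullet> (e_vec m i + e_vec m j) = x $ (i - 1) + x $ (j - 1)"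
        if "1 \<le> i \<and> i < j \<and> j \<le> m" for i j
        using that xe[of i] xe[of j] scalar_prod_minus_distrib[OF x e e]
          scalar_prod_add_distrib[OF x e e] by simp_all
      have ball1: "(\<forall>i\<in>{1..t}. P i) \<longleftrightarrow> (\<forall>i. 1 \<le> i \<and> i \<le> t \<longrightarrow> P i)" for P :: "nat \<Rightarrow> bool"
        by auto
      have ball2: "(\<forall>j\<in>{1..m}. \<forall>i\<in>{1..<j}. P i j \<and> Q i j) \<longleftrightarrow>
          (\<forall>i j. 1 \<le> i \<and> i < j \<and> j \<le> m \<longrightarrow> P i j) \<and>
          (\<forall>i j. 1 \<le> i \<and> i < j \<and> j \<le> m \<longrightarrow> Q i j)" for P Q :: "nat \<Rightarrow> nat \<Rightarrow> bool"
      proof -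
        have "j \<in> {1..m} \<and> i \<in> {1..<j} \<longleftrightarrow> 1 \<le> i \<and> i < j \<and> j \<le> m" for i j
          by auto
        then show ?thesis
          by blast
      qed
      show ?thesis
        unfolding ball1 ball2 by (simp only: 1 2 3 cong: imp_cong)
    qed
    finally show ?thesis .
  qed
  note eq = this
  have dim: "dim_row (D_mat m t s) = m"
    by (simp add: D_mat_def)
  show ?thesis
    unfolding char_quasi_poly_def dim
    by (rule arg_cong[where f = card], rule Collect_cong) (rule conj_cong[OF refl], simp only: eq)
qed

end

theory Submission
  imports Defs
begin

text \<open>
  Choose the coordinates \<open>x\<^sub>1, \<dots>, x\<^sub>m\<close> one after the other. The set \<open>K\<^sub>i\<close> of zeros of \<open>s\<^sub>i x\<close> in the
  ring of integers modulo \<open>q\<close> has \<open>gcd q s\<^sub>i\<close> elements, it is closed under negation, and it shrinks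
  as \<open>i\<close> grows since \<open>s\<^sub>t dvd \<dots> dvd s\<^sub>1\<close>. Hence every earlier coordinate lies outside \<open>K\<^sub>i\<close> and
  excludes exactly two further values of \<open>x\<^sub>i\<close>, or exactly one if it equals its own negative. The
  residues that equal their own negative are \<open>0\<close> and, for even \<open>q\<close>, \<open>q div 2\<close>, and the latter lies
  in \<open>K\<^sub>i\<close> iff \<open>s\<^sub>i\<close> is even; for \<open>i > t\<close> let \<open>K\<^sub>i\<close> be empty. Recording which of them have been used therefore turns the count into a recurrence; it
  also holds if no admissible values are left, because both sides are then zero.
\<close>

section \<open>Selections avoiding an involution\<close>

text \<open>Positions count from 0, so \<open>K n\<close> holds the values forbidden for coordinate
  \<open>n + 1\<close>. Residues enter only as a finite set with an involution that preserves each
  member of a decreasing chain.\<close>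

locale signed_selection =
  fixes G :: "'a set" and neg :: "'a \<Rightarrow> 'a" and K :: "nat \<Rightarrow> 'a set"
  assumes finite_G: "finite G"
    and neg_closed: "x \<in> G \<Longrightarrow> neg x \<in> G"
    and neg_neg: "x \<in> G \<Longrightarrow> neg (neg x) = x"
    and K_subset: "K n \<subseteq> G"
    and neg_K: "x \<in> K n \<Longrightarrow> neg x \<in> K n"
    and K_decreasing: "K (Suc n) \<subseteq> K n"
begin

definition avail :: "nat \<Rightarrow> 'a list \<Rightarrow> 'a set" where
  "avail n xs = G - K n - set xs - neg ` set xs"

text \<open>The latest choice is the head, so a list lists its coordinates backwards.\<close>

primrec sel :: "nat \<Rightarrow> 'a list set" where
  "sel 0 = {[]}"
| "sel (Suc n) = (\<lambda>(xs, x). x # xs) ` (SIGMA xs:sel n. avail n xs)"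

definition fixed :: "'a set" where
  "fixed = {x \<in> G. neg x = x}"

definition sel_fixed :: "nat \<Rightarrow> 'a set \<Rightarrow> 'a list set" where
  "sel_fixed n U = {xs \<in> sel n. set xs \<inter> fixed = U}"

text \<open>Integer valued, since a factor of the recurrence may become negative once no selections
  are left.\<close>

definition count_fixed :: "nat \<Rightarrow> 'a set \<Rightarrow> int" where
  "count_fixed n U = int (card (sel_fixed n U))"

lemma finite_fixed: "finite fixed"
  using finite_G by (simp add: fixed_def)

lemma finite_avail: "finite (avail n xs)"
  using finite_G by (simp add: avail_def)

lemma finite_sel: "finite (sel n)"
  by (induction n) (auto simp: finite_avail)

lemma finite_sel_fixed: "finite (sel_fixed n U)"
  using finite_sel by (simp add: sel_fixed_def)

section \<open>Chosen elements and the values they exclude\<close>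

lemma sel_length: "xs \<in> sel n \<Longrightarrow> length xs = n"
  by (induction n arbitrary: xs) auto

lemma sel_subset: "xs \<in> sel n \<Longrightarrow> set xs \<subseteq> G"
  by (induction n arbitrary: xs) (auto simp: avail_def, blast)

lemma sel_distinct: "xs \<in> sel n \<Longrightarrow> distinct xs"
  by (induction n arbitrary: xs) (auto simp: avail_def)

text \<open>An element chosen at position \<open>j < n\<close> avoided \<open>K j\<close>, which
  contains \<open>K n\<close>.\<close>

lemma sel_disjoint_K: "xs \<in> sel n \<Longrightarrow> set xs \<inter> K n = {}"
proof (induction n arbitrary: xs)
  case (Suc n)
  then obtain ys y where "xs = y # ys" "ys \<in> sel n" "y \<in> avail n ys"
    by auto
  then show ?case
    using Suc.IH[of ys] K_decreasing[of n] by (auto simp: avail_def)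
qed simp

lemma sel_neg_eq:
  assumes "xs \<in> sel n" "x \<in> set xs" "y \<in> set xs" "x = neg y"
  shows "x = y"
  using assms
proof (induction n arbitrary: xs)
  case (Suc n)
  then obtain ys z where *: "xs = z # ys" "ys \<in> sel n" "z \<in> avail n ys"
    by auto
  \<comment> \<open>With both equations at hand, either of \<open>x\<close> and \<open>y\<close> may
    be the head \<open>z\<close>.\<close>
  then have "y = neg x"
    using sel_subset[of xs "Suc n"] Suc.prems neg_neg by auto
  then show ?case
    using Suc * by (auto simp: avail_def)
qed simp

lemma neg_in_fixed_iff: "x \<in> G \<Longrightarrow> neg x \<in> fixed \<longleftrightarrow> x \<in> fixed"
  using neg_neg neg_closed by (auto simp: fixed_def)

text \<open>The \<open>n - card U\<close> moved elements chosen so far and their negatives are all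
  different and lie outside \<open>K n\<close> and \<open>fixed\<close>, so exactly twice that
  number of values is lost.\<close>

lemma card_avail_minus_fixed:
  assumes xs: "xs \<in> sel_fixed n U"
  shows "int (card (avail n xs - fixed)) =
    int (card G) - int (card (K n \<union> fixed)) - 2 * (int n - int (card U))"
proof -
  have sel: "xs \<in> sel n" and U: "set xs \<inter> fixed = U"
    using xs by (auto simp: sel_fixed_def)
  note G = sel_subset[OF sel]
  define V where "V = set xs - fixed"
  have inj: "inj_on neg V"
    using G neg_neg by (metis DiffD1 V_def inj_onI subset_iff)
  have finV: "finite V"
    by (simp add: V_def)
  have "card (set xs) = card V + card U"
    unfolding V_def U[symmetric] by (subst card_Un_disjoint[symmetric]) (auto intro: arg_cong[where f = card])
  moreover have "card (set xs) = n"
    using sel sel_length sel_distinct distinct_card by metis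
  ultimately have card_V: "int (card V) = int n - int (card U)"
    by simp
  have disj: "V \<inter> neg ` V = {}"
    using sel_neg_eq[OF sel] G by (auto simp: V_def fixed_def)
  have card_VV: "card (V \<union> neg ` V) = 2 * card V"
    using card_Un_disjoint[OF finV _ disj] finV card_image[OF inj] by simp
  \<comment> \<open>The right-hand set is stable under \<open>neg\<close>, so it contains the
    excluded pairs; this makes the subtraction of cardinalities exact.\<close>
  have sub: "V \<union> neg ` V \<subseteq> G - (K n \<union> fixed)"
  proof -
    have "V \<subseteq> G - (K n \<union> fixed)"
      using G sel_disjoint_K[OF sel] by (auto simp: V_def)
    moreover have "neg x \<in> G - (K n \<union> fixed)" if "x \<in> G - (K n \<union> fixed)" for x
      using that neg_closed neg_in_fixed_iff neg_K[of "neg x" n] neg_neg by auto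
    ultimately show ?thesis
      by blast
  qed
  have "avail n xs - fixed = (G - (K n \<union> fixed)) - (V \<union> neg ` V)"
    using G neg_in_fixed_iff by (auto simp: avail_def V_def)
  also have "int (card \<dots>) = int (card (G - (K n \<union> fixed))) - int (card (V \<union> neg ` V))"
    using card_Diff_subset[OF _ sub] card_mono[OF _ sub] finV finite_G by (simp add: of_nat_diff)
  also have "int (card (G - (K n \<union> fixed))) = int (card G) - int (card (K n \<union> fixed))"
  proof -
    have "K n \<union> fixed \<subseteq> G"
      using K_subset by (auto simp: fixed_def)
    from card_Diff_subset[OF _ this] card_mono[OF _ this] finite_subset[OF this] show ?thesis
      using finite_G
      by (simp add: of_nat_diff del: Un_subset_iff)
  qed
  finally show ?thesis
    using card_V card_VV by simp
qed

section \<open>The recurrence for selections with prescribed fixed points\<close>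

text \<open>The newest element is either moved, leaving \<open>U\<close> unchanged, or a fixed point
  \<open>u\<close> outside \<open>K n\<close>, before which exactly \<open>U - {u}\<close> had been
  used. The second family is indexed by \<open>u\<close> first so that its size is a sum over
  \<open>u\<close>.\<close>

lemma sel_fixed_Suc:
  assumes "U \<subseteq> fixed"
  shows "sel_fixed (Suc n) U = (\<lambda>(xs, x). x # xs) `
    ((SIGMA xs:sel_fixed n U. avail n xs - fixed) \<union>
     (\<lambda>(u, xs). (xs, u)) ` (SIGMA u:U - K n. sel_fixed n (U - {u})))"
    (is "_ = _ ` ?S")
proof -
  have "(xs \<in> sel n \<and> x \<in> avail n xs) \<and> set (x # xs) \<inter> fixed = U \<longleftrightarrow> (xs, x) \<in> ?S" for xs x
  proof (cases "x \<in> fixed")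
    case True
    have "x \<in> avail n xs \<longleftrightarrow> x \<notin> K n \<and> x \<notin> set xs" if xs: "xs \<in> sel n"
    proof -
      \<comment> \<open>A fixed point is the negative of an earlier choice only if it was itself
        that choice.\<close>
      have "x \<notin> neg ` set xs" if "x \<notin> set xs"
      proof
        assume "x \<in> neg ` set xs"
        then obtain y where y: "y \<in> set xs" "x = neg y"
          by blast
        then have "neg x = y"
          using sel_subset[OF xs] neg_neg by blast
        then show False
          using True y that by (simp add: fixed_def)
      qed
      then show ?thesis
        using True by (auto simp: avail_def fixed_def)
    qed
    then show ?thesis
      using True assms by (auto simp: sel_fixed_def image_iff)
  next
    case False
    then show ?thesis
      using assms by (auto simp: sel_fixed_def image_iff)
  qed
  note * = this
  have "sel_fixed (Suc n) U = (\<lambda>(xs, x). x # xs) `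
      {(xs, x). (xs \<in> sel n \<and> x \<in> avail n xs) \<and> set (x # xs) \<inter> fixed = U}"
    unfolding sel_fixed_def by auto
  also have "{(xs, x). (xs \<in> sel n \<and> x \<in> avail n xs) \<and> set (x # xs) \<inter> fixed = U} = ?S"
    using * by blast
  finally show ?thesis .
qed

lemma count_fixed_0: "count_fixed 0 U = (if U = {} then 1 else 0)"
proof -
  have "sel_fixed 0 U = (if U = {} then {[]} else {})"
    by (auto simp: sel_fixed_def)
  then show ?thesis
    by (simp add: count_fixed_def)
qed

text \<open>
  The first summand counts the selections whose new element is moved by the involution: the earlier
  elements that are moved exclude pairwise different pairs \<open>{x, neg x}\<close> outside \<open>K n\<close>.
\<close>

lemma count_fixed_Suc:
  assumes U: "U \<subseteq> fixed"
  shows "count_fixed (Suc n) U =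
    (int (card G) - int (card (K n \<union> fixed)) - 2 * (int n - int (card U))) * count_fixed n U +
    (\<Sum>u\<in>U - K n. count_fixed n (U - {u}))"
proof -
  let ?A = "SIGMA xs:sel_fixed n U. avail n xs - fixed"
  let ?B = "SIGMA u:U - K n. sel_fixed n (U - {u})"
  have finU: "finite U"
    using U finite_fixed finite_subset by blast
  have fin: "finite ?A" "finite ?B"
    using finU finite_sel_fixed finite_avail by auto
  have inj: "inj_on (\<lambda>(xs, x). x # xs) X" "inj_on (\<lambda>(u, xs). (xs, u)) Y"
    for X :: "('a list \<times> 'a) set" and Y :: "('a \<times> 'a list) set"
    by (auto simp: inj_on_def)
  have "card (sel_fixed (Suc n) U) = card (?A \<union> (\<lambda>(u, xs). (xs, u)) ` ?B)"
    unfolding sel_fixed_Suc[OF U] by (rule card_image[OF inj(1)])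
  also have "\<dots> = card ?A + card ?B"
    using U fin card_image[OF inj(2), of ?B] by (subst card_Un_disjoint) auto
  finally have "count_fixed (Suc n) U = (\<Sum>xs\<in>sel_fixed n U. int (card (avail n xs - fixed))) +
      (\<Sum>u\<in>U - K n. count_fixed n (U - {u}))"
    using finU finite_sel_fixed finite_avail by (simp add: count_fixed_def)
  also have "(\<Sum>xs\<in>sel_fixed n U. int (card (avail n xs - fixed))) =
      (\<Sum>xs\<in>sel_fixed n U.
        int (card G) - int (card (K n \<union> fixed)) - 2 * (int n - int (card U)))"
    using card_avail_minus_fixed by (rule sum.cong[OF refl])
  finally show ?thesis
    by (simp add: count_fixed_def mult.commute)
qed

lemma card_sel: "int (card (sel n)) = (\<Sum>U\<in>Pow fixed. count_fixed n U)"
proof -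
  have "card (\<Union>U\<in>Pow fixed. sel_fixed n U) = (\<Sum>U\<in>Pow fixed. card (sel_fixed n U))"
  proof (rule card_UN_disjoint)
    show "\<forall>U\<in>Pow fixed. \<forall>V\<in>Pow fixed. U \<noteq> V \<longrightarrow> sel_fixed n U \<inter> sel_fixed n V = {}"
      unfolding sel_fixed_def by blast
  qed (simp_all add: finite_fixed finite_sel_fixed)
  moreover have "(\<Union>U\<in>Pow fixed. sel_fixed n U) = sel n"
  proof (intro equalityI UN_least subsetI)
    fix xs assume "xs \<in> sel n"
    then have "xs \<in> sel_fixed n (set xs \<inter> fixed)"
      by (simp add: sel_fixed_def)
    then show "xs \<in> (\<Union>U\<in>Pow fixed. sel_fixed n U)"
      by (rule UN_I[rotated]) simp
  qed (simp add: sel_fixed_def)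
  ultimately show ?thesis
    unfolding count_fixed_def by (metis of_nat_sum)
qed

section \<open>Selections as vectors\<close>

text \<open>The reversal matches the order in which \<open>sel\<close> prepends; availability at
  each step becomes a condition on pairs \<open>i < j\<close>.\<close>

lemma map_rev_upt_in_sel_iff:
  "map x (rev [0..<n]) \<in> sel n \<longleftrightarrow>
    (\<forall>j<n. x j \<in> G - K j \<and> (\<forall>i<j. x j \<noteq> x i \<and> x j \<noteq> neg (x i)))"
proof (induction n)
  case (Suc n)
  have "map x (rev [0..<Suc n]) \<in> sel (Suc n) \<longleftrightarrow>
      map x (rev [0..<n]) \<in> sel n \<and> x n \<in> avail n (map x (rev [0..<n]))"
    by (auto simp: image_iff)
  also have "x n \<in> avail n (map x (rev [0..<n])) \<longleftrightarrow>
      x n \<in> G - K n \<and> (\<forall>i<n. x n \<noteq> x i \<and> x n \<noteq> neg (x i))"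
    by (auto simp: avail_def)
  finally show ?case
    by (auto simp: Suc.IH less_Suc_eq)
qed simp

lemma card_vectors:
  "card {x \<in> carrier_vec n. \<forall>j<n. x $ j \<in> G - K j \<and> (\<forall>i<j. x $ j \<noteq> x $ i \<and> x $ j \<noteq> neg (x $ i))} =
    card (sel n)" (is "card ?X = _")
proof (rule bij_betw_same_card, rule bij_betw_byWitness)
  let ?f = "\<lambda>x::'a vec. map (($) x) (rev [0..<n])"
  let ?g = "\<lambda>xs. vec n (\<lambda>i. xs ! (n - Suc i))"
  show "\<forall>x\<in>?X. ?g (?f x) = x"
    by (auto intro!: eq_vecI simp: rev_nth)
  show fg: "\<forall>xs\<in>sel n. ?f (?g xs) = xs"
    by (auto intro!: nth_equalityI simp: rev_nth sel_length)
  show "?f ` ?X \<subseteq> sel n"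
    by (auto simp only: map_rev_upt_in_sel_iff)
  show "?g ` sel n \<subseteq> ?X"
  proof
    fix x assume "x \<in> ?g ` sel n"
    then have "x \<in> carrier_vec n" "?f x \<in> sel n"
      using fg by auto
    then show "x \<in> ?X"
      unfolding map_rev_upt_in_sel_iff by blast
  qed
qed

end

text \<open>
  The leading factors make these identities hold also when the truncated bounds \<open>t + a - 1\<close> and
  \<open>t + a - 2\<close> leave no factor to split off.
\<close>

lemma prod_drop_last:
  fixes f :: "nat \<Rightarrow> int"
  shows "int a * (\<Prod>i = t+1..t+a-1. f i) * f (t + a) = int a * (\<Prod>i = t+1..t+a. f i)"
  by (cases a) simp_all

lemma prod_drop_last_two:
  fixes f :: "nat \<Rightarrow> int"
  shows "int a * (int a - 1) * (\<Prod>i = t+1..t+a-2. f i) * f (t + a - 1) =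
    int a * (int a - 1) * (\<Prod>i = t+1..t+a-1. f i)"
  using prod_drop_last[where a = "a - 1" and t = t and f = f] by (cases a) (simp_all add: mult.assoc)

section \<open>Solving the recurrence with one or two fixed points\<close>

context signed_selection
begin

text \<open>For \<open>U = {}\<close> the sum in the recurrence is empty, so each step contributes
  one factor; \<open>2 * n\<close> at position \<open>n\<close> becomes \<open>2 * i - 2\<close> in
  the numbering from 1.\<close>

lemma count_fixed_unfixed:
  assumes "\<And>n. n < t \<Longrightarrow> int (card (K n \<union> fixed)) = e (Suc n)"
    and "n \<le> t"
  shows "count_fixed n {} = (\<Prod>i = 1..n. int (card G) - e i - 2 * int i + 2)"
  using assms(2)
proof (induction n)
  case (Suc n)
  then show ?case
    using assms(1)[of n] by (simp add: count_fixed_Suc algebra_simps)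
qed (simp add: count_fixed_0)

text \<open>The point \<open>z\<close> is forbidden during the first \<open>t\<close> steps.
  Afterwards it may be left out, or be chosen at any of \<open>m - t\<close> positions, all of which
  give the same product with one factor fewer.\<close>

lemma card_sel_one_fixed:
  assumes fixed: "fixed = {z}" and tm: "t \<le> m"
    and K: "\<And>n. n < t \<Longrightarrow> z \<in> K n" "\<And>n. n < t \<Longrightarrow> card (K n) = d (Suc n)"
    and K_empty: "\<And>n. t \<le> n \<Longrightarrow> K n = {}"
  shows "int (card (sel m)) = chi_odd m t d (int (card G))"
proof -
  define q where "q = int (card G)"
  define A where "A = (\<Prod>i = 1..t. q - int (d i) - 2 * int i + 2)"
  let ?f = "\<lambda>i. q - 2 * int i + 1"
  have "K n \<union> fixed = K n" if "n < t" for n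
    using K(1)[OF that] fixed by auto
  then have A: "count_fixed t {} = A"
    using count_fixed_unfixed[of t "\<lambda>i. int (d i)" t] K(2) by (simp add: A_def q_def)
  have z: "count_fixed n {z} = 0" if "n \<le> t" for n
    using that
  proof (induction n)
    case (Suc n)
    then show ?case
      using K(1)[of n] fixed by (simp add: count_fixed_Suc)
  qed (simp add: count_fixed_0)
  \<comment> \<open>Once \<open>z\<close> is used, one pair fewer is excluded, which shifts the
    index of \<open>?f\<close> by one.\<close>
  have step: "count_fixed (Suc (t + a)) {} = ?f (t + Suc a) * count_fixed (t + a) {}"
    "count_fixed (Suc (t + a)) {z} = ?f (t + a) * count_fixed (t + a) {z} + count_fixed (t + a) {}"
    for a
    using K_empty[of "t + a"] fixed by (simp_all add: count_fixed_Suc q_def algebra_simps)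
  have empty: "count_fixed (t + a) {} = A * (\<Prod>i = t+1..t+a. ?f i)" for a
  proof (induction a)
    case (Suc a)
    then show ?case
      using step(1)[of a] by (simp add: mult_ac)
  qed (simp add: A)
  have "count_fixed (t + a) {z} = A * (int a * (\<Prod>i = t+1..t+a-1. ?f i))" for a
  proof (induction a)
    case (Suc a)
    have "count_fixed (t + Suc a) {z} =
        A * (int a * (\<Prod>i = t+1..t+a-1. ?f i) * ?f (t + a)) + A * (\<Prod>i = t+1..t+a. ?f i)"
      using step(2)[of a] Suc empty[of a] by (simp add: mult_ac)
    then show ?case
      unfolding prod_drop_last[where f = ?f] by (simp add: algebra_simps)
  qed (simp add: z)
  from this[of "m - t"] empty[of "m - t"]
  have "count_fixed m {} + count_fixed m {z} = chi_odd m t d q"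
    using tm by (simp add: chi_odd_def A_def distrib_left)
  moreover have "int (card (sel m)) = count_fixed m {} + count_fixed m {z}"
    by (simp add: card_sel fixed Pow_insert)
  ultimately show ?thesis
    by (simp add: q_def)
qed

text \<open>During the first \<open>r\<close> steps no fixed point can be chosen, from there up to
  step \<open>t\<close> only \<open>h\<close>, afterwards both. \<open>chi_even_P1\<close> collects
  the selections that do not use \<open>h\<close> within the first \<open>t\<close> steps,
  \<open>chi_even_P2\<close> those that do.\<close>

lemma card_sel_two_fixed:
  assumes fixed: "fixed = {z, h}" and zh: "z \<noteq> h" and rt: "r \<le> t" and tm: "t \<le> m"
    and K: "\<And>n. n < t \<Longrightarrow> z \<in> K n" "\<And>n. n < t \<Longrightarrow> card (K n) = d (Suc n)"
    and Kh: "\<And>n. h \<in> K n \<longleftrightarrow> n < r"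
    and K_empty: "\<And>n. t \<le> n \<Longrightarrow> K n = {}"
  shows "int (card (sel m)) = chi_even m r t d (int (card G))"
proof -
  define q where "q = int (card G)"
  define R where "R = (\<Prod>i = 1..r. q - int (d i) - 2 * int i + 2)"
  let ?g = "\<lambda>i. q - int (d i) - 2 * int i + 1"
  \<comment> \<open>The index \<open>i\<close> is the step at which \<open>h\<close> is chosen;
    later factors exceed \<open>?g\<close> by 2 because \<open>h\<close> excludes no pair.\<close>
  define S where "S n = (\<Sum>i = r+1..n. (\<Prod>j = r+1..i-1. ?g j) *
      (\<Prod>j = i+1..n. q - int (d j) - 2 * int j + 3))" for n
  define A where "A = R * (\<Prod>i = r+1..t. ?g i)"
  define B where "B = R * S t"
  let ?f = "\<lambda>i. q - 2 * int i"
  let ?h = "\<lambda>i. q - 2 * int i + 2"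
  have fin: "finite (K n)" for n
    using K_subset finite_G finite_subset by blast
  have union: "K n \<union> fixed = insert h (K n)" if "n < t" for n
    using K(1)[OF that] fixed by auto
  have low: "int (card (K n \<union> fixed)) = int (d (Suc n))" if "n < r" for n
    using union[of n] that rt Kh[of n] K(2)[of n] by (simp add: insert_absorb)
  have mid: "int (card (K n \<union> fixed)) = int (d (Suc n)) + 1" if "r \<le> n" "n < t" for n
    using union[of n] that fin Kh[of n] K(2)[of n] by simp
  have high: "int (card (K n \<union> fixed)) = 2" if "t \<le> n" for n
    using K_empty[OF that] fixed zh by simp
  have R: "count_fixed r {} = R"
    using count_fixed_unfixed[of r "\<lambda>i. int (d i)" r] low by (simp add: R_def q_def)
  \<comment> \<open>As \<open>z\<close> is forbidden, only \<open>h\<close> could be the fixed point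
    added last, and it would leave the impossible set \<open>{z}\<close>.\<close>
  have z: "count_fixed n {z} = 0" "count_fixed n {z, h} = 0" if "n \<le> t" for n
  proof -
    have "count_fixed n {z} = 0 \<and> count_fixed n {z, h} = 0"
      using that
    proof (induction n)
      case (Suc n)
      have "z \<in> K n"
        using Suc.prems K(1) by simp
      have "(\<Sum>u\<in>{z, h} - K n. count_fixed n ({z, h} - {u})) = 0"
      proof (rule sum.neutral, rule ballI)
        fix u assume "u \<in> {z, h} - K n"
        then have "u = h"
          using \<open>z \<in> K n\<close> by blast
        then have "{z, h} - {u} = {z}"
          using zh by blast
        then show "count_fixed n ({z, h} - {u}) = 0"
          using Suc by simp
      qed
      then show ?case
        using K(1)[of n] Suc fixed by (simp add: count_fixed_Suc)
    qed (simp add: count_fixed_0)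
    then show "count_fixed n {z} = 0" "count_fixed n {z, h} = 0"
      by blast+
  qed
  have h: "count_fixed n {h} = 0" if "n \<le> r" for n
    using that
  proof (induction n)
    case (Suc n)
    then show ?case
      using Kh[of n] fixed by (simp add: count_fixed_Suc)
  qed (simp add: count_fixed_0)
  have mid_empty: "count_fixed (r + a) {} = R * (\<Prod>i = r+1..r+a. ?g i)" if "r + a \<le> t" for a
    using that
  proof (induction a)
    case (Suc a)
    then show ?case
      using mid[of "r + a"] by (simp add: count_fixed_Suc q_def mult_ac)
  qed (simp add: R)
  have A: "count_fixed t {} = A"
    using mid_empty[of "t - r"] rt by (simp add: A_def)
  have mid_h: "count_fixed (r + a) {h} = R * S (r + a)" if "r + a \<le> t" for a
    using that
  proof (induction a)
    case (Suc a)
    \<comment> \<open>The last summand, where \<open>h\<close> is chosen at the final step, is split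
      off; its second product is empty.\<close>
    have "S (r + Suc a) = (\<Sum>i = r+1..r+a. (\<Prod>j = r+1..i-1. ?g j) *
        (\<Prod>j = i+1..r+Suc a. q - int (d j) - 2 * int j + 3)) + (\<Prod>i = r+1..r+a. ?g i)"
      by (simp add: S_def)
    also have "(\<Sum>i = r+1..r+a. (\<Prod>j = r+1..i-1. ?g j) *
          (\<Prod>j = i+1..r+Suc a. q - int (d j) - 2 * int j + 3)) =
        S (r + a) * (q - int (d (Suc (r + a))) - 2 * int (Suc (r + a)) + 3)"
      unfolding S_def sum_distrib_right by (rule sum.cong) (simp_all add: mult.assoc)
    finally have S_Suc: "S (r + Suc a) =
        S (r + a) * (q - int (d (Suc (r + a))) - 2 * int (Suc (r + a)) + 3) +
        (\<Prod>i = r+1..r+a. ?g i)" .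
    have "count_fixed (r + Suc a) {h} =
        (q - int (d (Suc (r + a))) - 2 * int (Suc (r + a)) + 3) * count_fixed (r + a) {h} +
        count_fixed (r + a) {}"
      using Suc.prems mid[of "r + a"] Kh[of "r + a"] fixed
      by (simp add: count_fixed_Suc q_def insert_Diff_if)
    then show ?case
      unfolding S_Suc using Suc mid_empty[of a] by (simp add: algebra_simps)
  qed (simp add: h S_def)
  have B: "count_fixed t {h} = B"
    using mid_h[of "t - r"] rt by (simp add: B_def)
  \<comment> \<open>At position \<open>n\<close> the factor is
    \<open>q - 2 - 2 * (n - card U)\<close>: each used fixed point raises it by 2, an index shift of
    one in \<open>?f\<close> or \<open>?h\<close>.\<close>
  have step:
    "count_fixed (Suc (t + a)) {} = ?f (t + Suc a) * count_fixed (t + a) {}"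
    "count_fixed (Suc (t + a)) {u} = ?f (t + a) * count_fixed (t + a) {u} + count_fixed (t + a) {}"
    "count_fixed (Suc (t + a)) {z, h} = ?h (t + a) * count_fixed (t + a) {z, h} +
      (count_fixed (t + a) {z} + count_fixed (t + a) {h})" if "u \<in> {z, h}" for a u
  proof -
    have "{z, h} - {z} = {h}" "{z, h} - {h} = {z}"
      using zh by auto
    then show
      "count_fixed (Suc (t + a)) {} = ?f (t + Suc a) * count_fixed (t + a) {}"
      "count_fixed (Suc (t + a)) {u} = ?f (t + a) * count_fixed (t + a) {u} + count_fixed (t + a) {}"
      "count_fixed (Suc (t + a)) {z, h} = ?h (t + a) * count_fixed (t + a) {z, h} +
        (count_fixed (t + a) {z} + count_fixed (t + a) {h})"
      using that K_empty[of "t + a"] high[of "t + a"] fixed zh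
      by (simp_all add: count_fixed_Suc q_def)
  qed
  have empty: "count_fixed (t + a) {} = A * (\<Prod>i = t+1..t+a. ?f i)" for a
  proof (induction a)
    case (Suc a)
    then show ?case
      using step(1)[of z a] by (simp add: mult_ac)
  qed (simp add: A)
  \<comment> \<open>The start value is 0 for \<open>z\<close> and \<open>B\<close> for
    \<open>h\<close>; the second term places \<open>u\<close> at one of the \<open>a\<close>
    positions after \<open>t\<close>.\<close>
  have single: "count_fixed (t + a) {u} =
      count_fixed t {u} * (\<Prod>i = t+1..t+a. ?h i) + A * (int a * (\<Prod>i = t+1..t+a-1. ?f i))"
    if u: "u \<in> {z, h}" for a u
  proof (induction a)
    case (Suc a)
    have "?f (t + a) = ?h (t + Suc a)"
      by simp
    with Suc step(2)[OF u, of a] empty[of a]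
    have "count_fixed (t + Suc a) {u} =
        count_fixed t {u} * ((\<Prod>i = t+1..t+a. ?h i) * ?h (t + Suc a)) +
        A * (int a * (\<Prod>i = t+1..t+a-1. ?f i) * ?f (t + a)) + A * (\<Prod>i = t+1..t+a. ?f i)"
      by (simp add: algebra_simps)
    then show ?case
      unfolding prod_drop_last[where f = ?f] by (simp add: algebra_simps)
  qed simp
  \<comment> \<open>Either \<open>h\<close> was chosen before and \<open>z\<close> takes one of
    \<open>a\<close> positions, or both are placed now, in \<open>a * (a - 1)\<close> ways.\<close>
  have both: "count_fixed (t + a) {z, h} = B * (int a * (\<Prod>i = t+1..t+a-1. ?h i)) +
      A * (int a * (int a - 1) * (\<Prod>i = t+1..t+a-2. ?f i))" for a
  proof (induction a)
    case (Suc a)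
    have last_two: "int a * (int a - 1) * (\<Prod>i = t+1..t+a-2. ?f i) * ?h (t + a) =
        int a * (int a - 1) * (\<Prod>i = t+1..t+a-1. ?f i)"
    \<comment> \<open>The shift from \<open>?h (t + a)\<close> to \<open>?f (t + a - 1)\<close>
      fails by truncation for \<open>t = a = 0\<close>, but then the leading factor
      vanishes.\<close>
    proof (cases a)
      case (Suc b)
      then have eq: "?h (t + a) = ?f (t + a - 1)"
        by simp
      show ?thesis
        unfolding eq by (rule prod_drop_last_two[where a = a and t = t and f = ?f])
    qed simp
    have "count_fixed (t + a) {z} + count_fixed (t + a) {h} =
        B * (\<Prod>i = t+1..t+a. ?h i) + 2 * (A * (int a * (\<Prod>i = t+1..t+a-1. ?f i)))"
      using single[of z a] single[of h a] z(1)[of t] B by simp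
    with Suc step(3)[of z a] have "count_fixed (t + Suc a) {z, h} = ?h (t + a) *
          (B * (int a * (\<Prod>i = t+1..t+a-1. ?h i)) +
           A * (int a * (int a - 1) * (\<Prod>i = t+1..t+a-2. ?f i))) +
        (B * (\<Prod>i = t+1..t+a. ?h i) + 2 * (A * (int a * (\<Prod>i = t+1..t+a-1. ?f i))))"
      by simp
    also have "\<dots> = B * (int a * (\<Prod>i = t+1..t+a-1. ?h i) * ?h (t + a)) +
        A * (int a * (int a - 1) * (\<Prod>i = t+1..t+a-2. ?f i) * ?h (t + a)) +
        B * (\<Prod>i = t+1..t+a. ?h i) + 2 * (A * (int a * (\<Prod>i = t+1..t+a-1. ?f i)))"
      by (simp only: ring_distribs mult_ac add_ac)
    finally have "count_fixed (t + Suc a) {z, h} =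
        B * (int a * (\<Prod>i = t+1..t+a-1. ?h i) * ?h (t + a)) +
        A * (int a * (int a - 1) * (\<Prod>i = t+1..t+a-2. ?f i) * ?h (t + a)) +
        B * (\<Prod>i = t+1..t+a. ?h i) + 2 * (A * (int a * (\<Prod>i = t+1..t+a-1. ?f i)))" .
    then show ?case
      unfolding prod_drop_last[where f = ?h] last_two by (simp add: algebra_simps)
  qed (simp add: z)
  have "count_fixed m {} + count_fixed m {z} + count_fixed m {h} + count_fixed m {z, h} =
      chi_even m r t d q"
    using tm empty[of "m - t"] single[of z "m - t"] single[of h "m - t"] both[of "m - t"] z(1)[of t] B
    by (simp add: chi_even_def chi_even_P1_def chi_even_P2_def A_def B_def R_def S_def of_nat_diff)
      (simp add: algebra_simps)
  moreover have "int (card (sel m)) =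
      count_fixed m {} + count_fixed m {z} + count_fixed m {h} + count_fixed m {z, h}"
  proof -
    have "Pow fixed = {{}, {z}, {h}, {z, h}}"
      unfolding fixed by (auto simp: Pow_insert)
    then show ?thesis
      using zh by (simp add: card_sel insert_eq_iff doubleton_eq_iff)
  qed
  ultimately show ?thesis
    by (simp add: q_def)
qed

end

section \<open>Residues modulo q\<close>

text \<open>Dividing by the gcd \<open>g\<close> leaves coprime \<open>q'\<close> and
  \<open>s'\<close>, so the solutions are the \<open>g\<close> multiples of \<open>q'\<close> below
  \<open>q\<close>.\<close>

lemma card_annihilator_mod:
  assumes "0 < q"
  shows "card {x \<in> {0..<int q}. int s * x mod int q = 0} = gcd q s"
proof -
  define g where "g = gcd q s"
  obtain q' s' where q: "q = g * q'" and s: "s = g * s'" and "coprime q' s'"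
    unfolding g_def using assms gcd_coprime_exists[of q s] by (auto simp: mult.commute)
  have pos: "0 < g" "0 < q'"
    using assms q by (auto intro: Nat.gr0I)
  have "int s * x mod int q = 0 \<longleftrightarrow> int q' dvd x" for x
  proof -
    have "int s * x mod int q = 0 \<longleftrightarrow> int g * int q' dvd int g * (int s' * x)"
      by (simp add: q s mod_eq_0_iff_dvd mult.assoc)
    also have "\<dots> \<longleftrightarrow> int q' dvd x"
      using pos \<open>coprime q' s'\<close> by (simp add: coprime_dvd_mult_right_iff)
    finally show ?thesis .
  qed
  then have "{x \<in> {0..<int q}. int s * x mod int q = 0} = (\<lambda>j. int q' * j) ` {0..<int g}"
    using pos by (auto simp: q zero_le_mult_iff elim!: dvdE)
  moreover have "inj_on (\<lambda>j. int q' * j) {0..<int g}"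
    using pos by (auto simp: inj_on_def)
  ultimately show ?thesis
    by (simp add: card_image g_def)
qed

lemma neg_mod_eq_self_iff:
  assumes "x \<in> {0..<int q}"
  shows "- x mod int q = x \<longleftrightarrow> x = 0 \<or> 2 * x = int q"
  using assms by (auto simp: zmod_zminus1_eq_if)

lemma ball_atLeast1AtMost: "(\<forall>i\<in>{1..n}. P i) \<longleftrightarrow> (\<forall>i<n. P (Suc i))"
  by (metis One_nat_def image_Suc_lessThan ball_simps(9) lessThan_iff)

context
  fixes m t q :: nat and s :: "nat \<Rightarrow> nat"
  assumes q: "0 < q" and tm: "t \<le> m"
    and chain: "\<forall>i\<in>{1..<t}. s (i + 1) dvd s i"
begin

text \<open>The condition \<open>n < t\<close> empties the set for coordinates without a column of
  the form \<open>s i\<close> times a unit vector.\<close>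

definition zeros :: "nat \<Rightarrow> int set" where
  "zeros n = {x \<in> {0..<int q}. n < t \<and> int (s (Suc n)) * x mod int q = 0}"

lemma signed_selection_mod: "signed_selection {0..<int q} (\<lambda>x. - x mod int q) zeros"
proof
  show "- (- x mod int q) mod int q = x" if "x \<in> {0..<int q}" for x
    using that by (simp add: mod_minus_eq)
  show "- x mod int q \<in> zeros n" if "x \<in> zeros n" for x n
  proof -
    have "int (s (Suc n)) * (- x mod int q) mod int q = - (int (s (Suc n)) * x) mod int q"
      by (simp add: mod_mult_right_eq)
    then show ?thesis
      using that q by (simp add: zeros_def zmod_zminus1_eq_if)
  qed
  show "zeros (Suc n) \<subseteq> zeros n" for n
  proof
    fix x assume x: "x \<in> zeros (Suc n)"
    \<comment> \<open>A residue killed by a divisor is killed by its multiples.\<close>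
    then have "s (Suc (Suc n)) dvd s (Suc n)"
      using chain by (auto simp: zeros_def)
    then have "int (s (Suc (Suc n))) * x dvd int (s (Suc n)) * x"
      by simp
    then show "x \<in> zeros n"
      using x by (auto simp: zeros_def mod_eq_0_iff_dvd dvd_trans)
  qed
qed (use q in \<open>auto simp: zeros_def\<close>)

interpretation signed_selection "{0..<int q}" "\<lambda>x. - x mod int q" zeros
  by (rule signed_selection_mod)

text \<open>For reduced residues, nonzero difference and sum say that the later coordinate is
  neither the earlier one nor its negative, which is availability in \<open>sel\<close>.\<close>

lemma char_quasi_poly_eq_card_sel: "char_quasi_poly (D_mat m t s) q = card (sel m)"
proof -
  have diff: "(a - b) mod int q \<noteq> 0 \<longleftrightarrow> b \<noteq> a" and sum: "(a + b) mod int q \<noteq> 0 \<longleftrightarrow> b \<noteq> - a mod int q"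
    if "a \<in> {0..<int q}" "b \<in> {0..<int q}" for a b
  proof -
    have "a mod int q = a" "b mod int q = b"
      using that by auto
    then show "(a - b) mod int q \<noteq> 0 \<longleftrightarrow> b \<noteq> a" "(a + b) mod int q \<noteq> 0 \<longleftrightarrow> b \<noteq> - a mod int q"
      using mod_eq_dvd_iff[of a "int q" b] mod_eq_dvd_iff[of b "int q" "- a"]
      by (auto simp: mod_eq_0_iff_dvd add.commute)
  qed
  have "(\<forall>i<m. x i \<in> {0..<int q}) \<and> (\<forall>i<t. int (s (Suc i)) * x i mod int q \<noteq> 0) \<and>
      (\<forall>j<m. \<forall>i<j. (x i - x j) mod int q \<noteq> 0 \<and> (x i + x j) mod int q \<noteq> 0) \<longleftrightarrow>
    (\<forall>j<m. x j \<in> {0..<int q} - zeros j \<and> (\<forall>i<j. x j \<noteq> x i \<and> x j \<noteq> - x i mod int q))"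
    (is "?L \<longleftrightarrow> ?R") for x :: "nat \<Rightarrow> int"
  proof (cases "\<forall>i<m. x i \<in> {0..<int q}")
    case True
    have pairs: "(\<forall>j<m. \<forall>i<j. (x i - x j) mod int q \<noteq> 0 \<and> (x i + x j) mod int q \<noteq> 0) \<longleftrightarrow>
        (\<forall>j<m. \<forall>i<j. x j \<noteq> x i \<and> x j \<noteq> - x i mod int q)"
      using True diff sum by (meson less_trans)
    have "x i \<in> zeros i \<longleftrightarrow> i < t \<and> int (s (Suc i)) * x i mod int q = 0" if "i < m" for i
      using True that by (simp add: zeros_def)
    then have zeros: "(\<forall>i<t. int (s (Suc i)) * x i mod int q \<noteq> 0) \<longleftrightarrow> (\<forall>i<m. x i \<notin> zeros i)"
      using less_le_trans[OF _ tm] by metis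
    show ?thesis
      unfolding pairs zeros using True by auto
  next
    case False
    then show ?thesis
      by auto
  qed
  then show ?thesis
    unfolding char_quasi_poly_D_mat[OF tm] card_vectors[symmetric] ball_atLeast1AtMost
      atLeastLessThanSuc_atLeastAtMost diff_Suc_1
    by simp
qed

lemma card_zeros:
  assumes "\<forall>i\<in>{1..t}. d i = gcd q (s i)" and "n < t"
  shows "card (zeros n) = d (Suc n)"
  using assms card_annihilator_mod[OF q, of "s (Suc n)"] by (simp add: zeros_def)

text \<open>For odd \<open>q\<close> the equation \<open>2 * x = q\<close> has no solution, so 0 is
  the only fixed point.\<close>

lemma char_quasi_poly_D_mat_odd:
  assumes d: "\<forall>i\<in>{1..t}. d i = gcd q (s i)" and "odd q"
  shows "int (char_quasi_poly (D_mat m t s) q) = chi_odd m t d (int q)"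
proof -
  have "2 * x \<noteq> int q" for x
    using \<open>odd q\<close> by (metis dvd_triv_left even_of_nat)
  then have "fixed = {0}"
    using q by (auto simp: fixed_def neg_mod_eq_self_iff)
  then have "int (card (sel m)) = chi_odd m t d (int (card {0..<int q}))"
    using q card_zeros[OF d] by (intro card_sel_one_fixed tm) (auto simp: zeros_def)
  then show ?thesis
    by (simp add: char_quasi_poly_eq_card_sel)
qed

lemma char_quasi_poly_D_mat_even:
  assumes d: "\<forall>i\<in>{1..t}. d i = gcd q (s i)" and "even q" and rt: "r \<le> t"
    and s: "\<forall>i\<in>{1..r}. even (s i)" "\<forall>i\<in>{r+1..t}. odd (s i)"
  shows "int (char_quasi_poly (D_mat m t s) q) = chi_even m r t d (int q)"
proof -
  obtain h where h: "q = 2 * h"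
    using \<open>even q\<close> by blast
  then have "0 < h"
    using q by simp
  have "x \<in> fixed \<longleftrightarrow> x = 0 \<or> x = int h" for x
  proof -
    have "x \<in> fixed \<longleftrightarrow> x \<in> {0..<int q} \<and> (x = 0 \<or> 2 * x = int q)"
      by (auto simp only: fixed_def mem_Collect_eq neg_mod_eq_self_iff)
    also have "\<dots> \<longleftrightarrow> x = 0 \<or> x = int h"
      using \<open>0 < h\<close> by (auto simp: h)
    finally show ?thesis .
  qed
  then have "fixed = {0, int h}"
    by blast
  \<comment> \<open>Multiplying \<open>q / 2\<close> by \<open>s (Suc n)\<close> gives 0 modulo
    \<open>q\<close> iff \<open>s (Suc n)\<close> is even; among positions below \<open>t\<close>
    these are the first \<open>r\<close>.\<close>
  moreover have "int h \<in> zeros n \<longleftrightarrow> n < r" for n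
  proof -
    have "int (s (Suc n)) * int h mod int q = 0 \<longleftrightarrow> int 2 * int h dvd int (s (Suc n)) * int h"
      by (simp add: h mod_eq_0_iff_dvd)
    also have "\<dots> \<longleftrightarrow> even (s (Suc n))"
      using \<open>0 < h\<close> by (simp only: dvd_mult_cancel_right) simp
    finally have ev: "int (s (Suc n)) * int h mod int q = 0 \<longleftrightarrow> even (s (Suc n))" .
    have "int h \<in> {0..<int q}"
      using \<open>0 < h\<close> by (simp add: h)
    then have "int h \<in> zeros n \<longleftrightarrow> n < t \<and> even (s (Suc n))"
      unfolding zeros_def mem_Collect_eq ev by blast
    also have "\<dots> \<longleftrightarrow> n < r"
      using s rt by (cases "n < r") auto
    finally show ?thesis .
  qed
  ultimately have "int (card (sel m)) = chi_even m r t d (int (card {0..<int q}))"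
    using q \<open>0 < h\<close> card_zeros[OF d] by (intro card_sel_two_fixed[where z = 0 and h = "int h"] tm rt)
      (auto simp: zeros_def)
  then show ?thesis
    by (simp add: char_quasi_poly_eq_card_sel)
qed

end

section \<open>Constituents\<close>

lemma poly_chi_odd: "poly (chi_odd m t d [:0, 1:]) x = chi_odd m t d x"
  by (simp add: chi_odd_def poly_prod)

lemma poly_chi_even: "poly (chi_even m r t d [:0, 1:]) x = chi_even m r t d x"
  by (simp add: chi_even_def chi_even_P1_def chi_even_P2_def poly_prod poly_sum)

text \<open>For \<open>t = m\<close> the bracket is an empty product plus a zero multiple, hence
  1.\<close>

lemma chi_odd_full_eq: "chi_odd_full m d x = chi_odd m m d x"
  by (simp add: chi_odd_full_def chi_odd_def)

lemma chi_even_full_eq: "chi_even_full m r d x = chi_even m r m d x"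
  by (simp add: chi_even_full_def chi_even_def chi_even_P1_def chi_even_P2_def)

text \<open>Two polynomials agreeing on an infinite residue class are equal, which gives the
  uniqueness that \<open>THE\<close> requires.\<close>

lemma constituent_eqI:
  assumes "0 < \<rho>" and p: "\<And>q. 0 < q \<Longrightarrow> [q = k] (mod \<rho>) \<Longrightarrow> int (f q) = poly p (int q)"
  shows "constituent f \<rho> k = p"
  unfolding constituent_def
proof (rule the_equality)
  fix p' :: "int poly"
  assume p': "\<forall>q>0. [q = k] (mod \<rho>) \<longrightarrow> int (f q) = poly p' (int q)"
  \<comment> \<open>\<open>Suc n\<close> keeps the argument positive even for
    \<open>k = 0\<close>.\<close>
  let ?q = "\<lambda>n. k + \<rho> * Suc n"
  have "poly (p' - p) (int (?q n)) = 0" for n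
  proof -
    have "0 < ?q n" "[?q n = k] (mod \<rho>)"
      using assms(1) by (simp, simp only: cong_def mod_mult_self2)
    then show ?thesis
      using p p' by (metis poly_diff right_minus_eq)
  qed
  then have "range (\<lambda>n. int (?q n)) \<subseteq> {x. poly (p' - p) x = 0}"
    by blast
  moreover have "inj (\<lambda>n. int (?q n))"
    using assms(1) by (auto simp: inj_def)
  then have "infinite (range (\<lambda>n. int (?q n)))"
    by (rule range_inj_infinite)
  ultimately have "p' - p = 0"
    using poly_roots_finite finite_subset by blast
  then show "p' = p"
    by simp
qed (use p in blast)

lemma dvd_D_period:
  assumes "\<forall>i\<in>{1..<t}. s (i + 1) dvd s i" and "i \<in> {1..t}"
  shows "s i dvd D_period t s"
proof -
  have "1 \<le> i" "i \<le> t"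
    using assms(2) by auto
  then have "s i dvd s 1"
  proof (induction i rule: dec_induct)
    case (step n)
    then show ?case
      using assms(1) dvd_trans[of "s (Suc n)" "s n" "s 1"] by auto
  qed simp
  then show ?thesis
    using assms(2) by (auto simp: D_period_def)
qed

theorem theorem3p5:
  fixes m r t k \<rho> :: nat and s d :: "nat \<Rightarrow> nat"
  assumes "0 < m" and "r \<le> t" and "t \<le> m"
    and "\<forall>i\<in>{1..t}. 0 < s i"
    and "\<forall>i\<in>{1..r}. even (s i)"
    and "\<forall>i\<in>{r+1..t}. odd (s i)"
    and "\<forall>i\<in>{1..<t}. s (i + 1) dvd s i"
    and "\<rho> = D_period t s"
    and "0 < k" and "k dvd \<rho>"
    and "\<forall>i\<in>{1..t}. d i = gcd k (s i)"
  shows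
    "(odd k \<longrightarrow> (\<forall>q \<in> {k + \<rho> * n | n. True}.
        int (char_quasi_poly (D_mat m t s) q) = chi_odd m t d (int q))) \<and>
     (even k \<longrightarrow> (\<forall>q \<in> {k + \<rho> * n | n. True}.
        int (char_quasi_poly (D_mat m t s) q) = chi_even m r t d (int q))) \<and>
     (t = m \<and> odd k \<longrightarrow> (\<forall>q \<in> {k + \<rho> * n | n. True}.
        int (char_quasi_poly (D_mat m t s) q) = chi_odd_full m d (int q))) \<and>
     (t = m \<and> even k \<longrightarrow> (\<forall>q \<in> {k + \<rho> * n | n. True}.
        int (char_quasi_poly (D_mat m t s) q) = chi_even_full m r d (int q))) \<and>
     is_quasi_polynomial (char_quasi_poly (D_mat m t s)) \<rho> \<and>
     (odd k \<longrightarrow>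
        constituent (char_quasi_poly (D_mat m t s)) \<rho> k = chi_odd m t d [:0, 1:]) \<and>
     (even k \<longrightarrow>
        constituent (char_quasi_poly (D_mat m t s)) \<rho> k = chi_even m r t d [:0, 1:]) \<and>
     (t = m \<and> odd k \<longrightarrow>
        constituent (char_quasi_poly (D_mat m t s)) \<rho> k = chi_odd_full m d [:0, 1:]) \<and>
     (t = m \<and> even k \<longrightarrow>
        constituent (char_quasi_poly (D_mat m t s)) \<rho> k = chi_even_full m r d [:0, 1:])"
proof -
  let ?f = "char_quasi_poly (D_mat m t s)"
  have pos: "0 < \<rho>"
    using assms(4) by (auto simp: assms(8) D_period_def lcm_pos_nat)
  have "even \<rho>"
    by (simp add: assms(8) D_period_def)
  \<comment> \<open>All residues \<open>l\<close> are treated, since a quasi-polynomial needs a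
    polynomial for each. The gcd with \<open>s i\<close> and the parity depend only on the residue,
    because \<open>s i\<close> and 2 divide \<open>\<rho>\<close>.\<close>
  have main: "(odd l \<longrightarrow> int (?f q) = chi_odd m t e (int q)) \<and>
      (even l \<longrightarrow> int (?f q) = chi_even m r t e (int q))"
    if "0 < q" and cong: "[q = l] (mod \<rho>)" and e: "\<forall>i\<in>{1..t}. e i = gcd l (s i)" for q l e
  proof -
    have "\<forall>i\<in>{1..t}. e i = gcd q (s i)"
    proof
      fix i assume i: "i \<in> {1..t}"
      then have "[q = l] (mod s i)"
        using cong_dvd_modulus_nat[OF cong] dvd_D_period[OF assms(7)] assms(8) by blast
      then show "e i = gcd q (s i)"
        using e i cong_gcd_eq by metis
    qed
    moreover have "even q \<longleftrightarrow> even l"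
      using cong_dvd_modulus_nat[OF cong \<open>even \<rho>\<close>] by (rule cong_dvd_iff)
    ultimately show ?thesis
      using char_quasi_poly_D_mat_odd[OF \<open>0 < q\<close> assms(3,7)]
        char_quasi_poly_D_mat_even[OF \<open>0 < q\<close> assms(3,7) _ _ assms(2,5,6)] by blast
  qed
  have "is_quasi_polynomial ?f \<rho>"
    unfolding is_quasi_polynomial_def
  proof (intro conjI pos allI)
    fix l
    let ?e = "\<lambda>i. gcd l (s i)"
    show "\<exists>p :: int poly. \<forall>q>0. [q = l] (mod \<rho>) \<longrightarrow> int (?f q) = poly p (int q)"
    proof (cases "odd l")
      case True
      then show ?thesis
        using main[of _ l ?e] by (intro exI[of _ "chi_odd m t ?e [:0, 1:]"]) (simp add: poly_chi_odd)
    next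
      case False
      then show ?thesis
        using main[of _ l ?e] by (intro exI[of _ "chi_even m r t ?e [:0, 1:]"]) (simp add: poly_chi_even)
    qed
  qed
  moreover have "odd k \<longrightarrow> constituent ?f \<rho> k = chi_odd m t d [:0, 1:]"
    "even k \<longrightarrow> constituent ?f \<rho> k = chi_even m r t d [:0, 1:]"
    using main[OF _ _ assms(11)]
    by (auto intro!: constituent_eqI[OF pos] simp: poly_chi_odd poly_chi_even)
  moreover have "odd k \<longrightarrow> (\<forall>q \<in> {k + \<rho> * n | n. True}. int (?f q) = chi_odd m t d (int q))"
    "even k \<longrightarrow> (\<forall>q \<in> {k + \<rho> * n | n. True}. int (?f q) = chi_even m r t d (int q))"
  proof -
    have q: "0 < q" "[q = k] (mod \<rho>)" if "q \<in> {k + \<rho> * n | n. True}" for q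
      using that assms(9) by (auto simp: cong_def)
    show
      "odd k \<longrightarrow> (\<forall>q \<in> {k + \<rho> * n | n. True}. int (?f q) = chi_odd m t d (int q))"
      "even k \<longrightarrow> (\<forall>q \<in> {k + \<rho> * n | n. True}. int (?f q) = chi_even m r t d (int q))"
      using main[OF q assms(11)] by (intro impI ballI; simp)+
  qed
  ultimately show ?thesis
    unfolding chi_odd_full_eq chi_even_full_eq by (cases "t = m") simp_all
qed

end
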